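(* Let $(X,T)$ be a multi-sensitive system. Then $(X,T)$ has positive topological sequence entropy, i.e. there is an increasing sequence $\mathcal{N}=\{n_1<n_2<\cdots\}$ of positive integers such that $h_{\mathcal{N}}(T)>0$.
   Context: A dynamical system $(X,T)$ consists of a nonempty compact metric space $X$ (metric $d$) and a continuous surjective map $T:X\to X$; by standing assumption $X$ has no isolated points and is not a singleton. $\mathbb{Z}_+$ is the set of nonnegative integers. "Opene" means open and nonempty. For $\delta>0$ and opene $U\subset X$, $S_T(U,\delta)=\{n\in\mathbb{Z}_+:\text{there are }x_1,x_2\in U\text{ with }d(T^nx_1,T^nx_2)>\delta\}$. The system is multi-sensitive if there is $\delta>0$ such that $\bigcap_{i=1}^kS_T(U_i,\delta)\neq\varnothing$ for every finite collection of opene $U_1,\dots,U_k\subset X$. For an increasing sequence $\mathcal{N}=\{n_1<n_2<\cdots\}$ of positive integers, put $n_0=0$ and, for $k\ge1$, $d_k(x,y)=\max_{0\le j\le k-1}d(T^{n_j}x,T^{n_j}y)$. A subset $E\subset X$ is $(k,T,\epsilon)$-separated (with respect to $\mathcal{N}$) if $d_k(x,y)>\epsilon$ for any two distinct $x,y\in E$; $\mathrm{sep}(k,T,\epsilon)$ is the maximal cardinality of such a set. The topological sequence entropy along $\mathcal{N}$ is $h_{\mathcal{N}}(T)=\lim_{\epsilon\to0}\limsup_{k\to\infty}\frac1k\log\mathrm{sep}(k,T,\epsilon)$. *)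

theory Defs
  imports "HOL-Analysis.Analysis"
begin

definition dynamical_system :: "'a::metric_space set \<Rightarrow> ('a \<Rightarrow> 'a) \<Rightarrow> bool" where
  "dynamical_system X T \<longleftrightarrow>
     compact X \<and> X \<noteq> {} \<and> continuous_on X T \<and> T ` X = X \<and>
     (\<forall>x\<in>X. x islimpt X) \<and> (\<nexists>x. X = {x})"

definition opene :: "'a::metric_space set \<Rightarrow> 'a set \<Rightarrow> bool" where
  "opene X U \<longleftrightarrow> openin (top_of_set X) U \<and> U \<noteq> {}"

definition sens_times :: "('a::metric_space \<Rightarrow> 'a) \<Rightarrow> 'a set \<Rightarrow> real \<Rightarrow> nat set" where
  "sens_times T U \<delta> = {n. \<exists>x1\<in>U. \<exists>x2\<in>U. dist ((T ^^ n) x1) ((T ^^ n) x2) > \<delta>}"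

definition multi_sensitive :: "'a::metric_space set \<Rightarrow> ('a \<Rightarrow> 'a) \<Rightarrow> bool" where
  "multi_sensitive X T \<longleftrightarrow>
     (\<exists>\<delta>>0. \<forall>\<U>. finite \<U> \<and> (\<forall>U\<in>\<U>. opene X U) \<longrightarrow> (\<Inter>U\<in>\<U>. sens_times T U \<delta>) \<noteq> {})"

text \<open>A sequence of positive integers \<open>n\<^sub>1 < n\<^sub>2 < \<dots>\<close> is represented by \<open>N\<close> with
  \<open>N i = n\<^sub>i\<^sub>+\<^sub>1\<close>; \<open>seq_time\<close> prepends \<open>n\<^sub>0 = 0\<close>, so that \<open>seq_time N j = n\<^sub>j\<close>.\<close>

definition seq_time :: "(nat \<Rightarrow> nat) \<Rightarrow> nat \<Rightarrow> nat" where
  "seq_time N j = (case j of 0 \<Rightarrow> 0 | Suc i \<Rightarrow> N i)"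

text \<open>Only meaningful for \<open>k \<ge> 1\<close>; the value at \<open>k = 0\<close> does not affect the limit superior below.\<close>

definition seq_dist ::
  "(nat \<Rightarrow> nat) \<Rightarrow> ('a::metric_space \<Rightarrow> 'a) \<Rightarrow> nat \<Rightarrow> 'a \<Rightarrow> 'a \<Rightarrow> real" where
  "seq_dist N T k x y =
     Max ((\<lambda>j. dist ((T ^^ seq_time N j) x) ((T ^^ seq_time N j) y)) ` {..<k})"

definition separated ::
  "(nat \<Rightarrow> nat) \<Rightarrow> 'a::metric_space set \<Rightarrow> ('a \<Rightarrow> 'a) \<Rightarrow> nat \<Rightarrow> real \<Rightarrow> 'a set \<Rightarrow> bool" where
  "separated N X T k \<epsilon> E \<longleftrightarrow>
     E \<subseteq> X \<and> (\<forall>x\<in>E. \<forall>y\<in>E. x \<noteq> y \<longrightarrow> seq_dist N T k x y > \<epsilon>)"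

text \<open>The maximum is taken over a finite set of numbers, and all separated sets are finite, when
  \<open>X\<close> is compact, \<open>T\<close> is a continuous self-map of \<open>X\<close>, \<open>k \<ge> 1\<close> and \<open>\<epsilon> > 0\<close>; see
  \<open>separated_card_bounded\<close> below.\<close>

definition sep ::
  "(nat \<Rightarrow> nat) \<Rightarrow> 'a::metric_space set \<Rightarrow> ('a \<Rightarrow> 'a) \<Rightarrow> nat \<Rightarrow> real \<Rightarrow> nat" where
  "sep N X T k \<epsilon> = Max (card ` {E. separated N X T k \<epsilon> E})"

definition sep_growth ::
  "(nat \<Rightarrow> nat) \<Rightarrow> 'a::metric_space set \<Rightarrow> ('a \<Rightarrow> 'a) \<Rightarrow> real \<Rightarrow> ereal" where
  "sep_growth N X T \<epsilon> = limsup (\<lambda>k. ereal (ln (real (sep N X T k \<epsilon>)) / real k))"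

text \<open>The limit exists in the extended reals for dynamical systems; see
  \<open>sep_growth_tendsto_seq_entropy\<close> below.\<close>

definition seq_entropy ::
  "(nat \<Rightarrow> nat) \<Rightarrow> 'a::metric_space set \<Rightarrow> ('a \<Rightarrow> 'a) \<Rightarrow> ereal" where
  "seq_entropy N X T = Lim (at_right 0) (sep_growth N X T)"

lemma dynamical_system_funpow:
  assumes "dynamical_system X T"
  shows "continuous_on X (T ^^ n)" "(T ^^ n) ` X \<subseteq> X"
proof (induction n)
  case 0
  show "continuous_on X (T ^^ 0)" "(T ^^ 0) ` X \<subseteq> X" by (auto simp: id_def)
next
  case (Suc n)
  have T: "continuous_on X T" "T ` X = X"
    using assms by (auto simp: dynamical_system_def)
  have "continuous_on ((T ^^ n) ` X) T" using T(1) Suc(2) continuous_on_subset by blast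
  then show "continuous_on X (T ^^ Suc n)"
    using continuous_on_compose[OF Suc(1)] by simp
  show "(T ^^ Suc n) ` X \<subseteq> X" using Suc(2) T(2) by (auto simp: image_subset_iff)
qed

lemma separated_card_bounded:
  assumes "dynamical_system X T" and "k \<ge> 1" and "\<epsilon> > 0"
  shows "\<exists>B. \<forall>E. separated N X T k \<epsilon> E \<longrightarrow> finite E \<and> card E \<le> B"
proof -
  define f where "f j = T ^^ seq_time N j" for j
  define V where "V x = {y\<in>X. \<forall>j<k. dist (f j x) (f j y) < \<epsilon>/2}" for x
  have V_open: "openin (top_of_set X) (V x)" for x
  proof -
    have "openin (top_of_set X) {y\<in>X. dist (f j x) (f j y) < \<epsilon>/2}" for j
    proof -
      have "continuous_on X (f j)"
        using dynamical_system_funpow[OF assms(1)] by (simp add: f_def)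
      then have "openin (top_of_set X) (X \<inter> f j -` ball (f j x) (\<epsilon>/2))"
        by (rule continuous_openin_preimage_gen[OF _ open_ball])
      moreover have "X \<inter> f j -` ball (f j x) (\<epsilon>/2) = {y\<in>X. dist (f j x) (f j y) < \<epsilon>/2}"
        by auto
      ultimately show ?thesis by simp
    qed
    moreover have "finite {..<k}" "{..<k} \<noteq> {}" using assms(2) by (auto simp: lessThan_empty_iff)
    ultimately have "openin (top_of_set X) (\<Inter>j\<in>{..<k}. {y\<in>X. dist (f j x) (f j y) < \<epsilon>/2})"
      by (intro openin_INT2)
    moreover have "(\<Inter>j\<in>{..<k}. {y\<in>X. dist (f j x) (f j y) < \<epsilon>/2}) = V x"
      using \<open>{..<k} \<noteq> {}\<close> by (auto simp: V_def simp del: lessThan_empty_iff)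
    ultimately show ?thesis by simp
  qed
  have "compact X" using assms(1) by (simp add: dynamical_system_def)
  moreover have "\<And>U. U \<in> V ` X \<Longrightarrow> openin (top_of_set X) U" using V_open by blast
  moreover have "X \<subseteq> \<Union>(V ` X)" using assms(3) by (auto simp: V_def)
  ultimately obtain \<D> where "\<D> \<subseteq> V ` X" "finite \<D>" "X \<subseteq> \<Union>\<D>"
    by (metis compact_eq_openin_cover)
  then obtain D where D: "D \<subseteq> X" "finite D" "X \<subseteq> (\<Union>x\<in>D. V x)"
    by (metis finite_subset_image)
  have "finite E \<and> card E \<le> card D" if E: "separated N X T k \<epsilon> E" for E
  proof -
    have "\<forall>y\<in>E. \<exists>x\<in>D. y \<in> V x" using E D(3) by (auto simp: separated_def)
    then obtain c where c: "\<And>y. y \<in> E \<Longrightarrow> c y \<in> D \<and> y \<in> V (c y)" by metis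
    have "inj_on c E"
    proof (rule inj_onI, rule ccontr)
      fix y z assume yz: "y \<in> E" "z \<in> E" "c y = c z" "y \<noteq> z"
      have "dist (f j y) (f j z) < \<epsilon>" if "j < k" for j
      proof -
        have "dist (f j (c y)) (f j y) < \<epsilon>/2" "dist (f j (c y)) (f j z) < \<epsilon>/2"
          using c[of y] c[of z] yz that by (auto simp: V_def)
        then show ?thesis using dist_triangle_half_r by blast
      qed
      then have "seq_dist N T k y z < \<epsilon>"
        using assms(2) by (subst seq_dist_def, subst Max_less_iff) (auto simp: f_def lessThan_empty_iff)
      moreover have "\<epsilon> < seq_dist N T k y z" using E yz unfolding separated_def by blast
      ultimately show False by simp
    qed
    moreover have "c ` E \<subseteq> D" using c by auto
    ultimately show ?thesis using D(2) by (meson inj_on_finite card_inj_on_le)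
  qed
  then show ?thesis by blast
qed

lemma finite_card_separated:
  assumes "dynamical_system X T" and "k \<ge> 1" and "\<epsilon> > 0"
  shows "finite (card ` {E. separated N X T k \<epsilon> E})"
proof -
  obtain B where "\<And>E. separated N X T k \<epsilon> E \<Longrightarrow> card E \<le> B"
    using separated_card_bounded[OF assms] by blast
  then have "card ` {E. separated N X T k \<epsilon> E} \<subseteq> {..B}" by auto
  then show ?thesis by (rule finite_subset) simp
qed

lemma sep_ge_1:
  assumes "dynamical_system X T" and "k \<ge> 1" and "\<epsilon> > 0"
  shows "sep N X T k \<epsilon> \<ge> 1"
proof -
  obtain x where "x \<in> X" using assms(1) by (auto simp: dynamical_system_def)
  then have "separated N X T k \<epsilon> {x}" by (simp add: separated_def)
  then have "card {x} \<in> card ` {E. separated N X T k \<epsilon> E}" by blast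
  then show ?thesis
    unfolding sep_def using Max_ge[OF finite_card_separated[OF assms]] by fastforce
qed

lemma sep_antimono:
  assumes "dynamical_system X T" and "k \<ge> 1" and "0 < \<epsilon>" and "\<epsilon> \<le> \<epsilon>'"
  shows "sep N X T k \<epsilon>' \<le> sep N X T k \<epsilon>"
proof -
  have "separated N X T k \<epsilon>' {}" by (simp add: separated_def)
  then have "card ` {E. separated N X T k \<epsilon>' E} \<noteq> {}" by blast
  moreover have "{E. separated N X T k \<epsilon>' E} \<subseteq> {E. separated N X T k \<epsilon> E}"
    using assms(4) unfolding separated_def by (blast intro: le_less_trans)
  ultimately show ?thesis
    unfolding sep_def using finite_card_separated[OF assms(1-3)]
    by (intro Max_mono) auto
qed

lemma sep_growth_antimono:
  assumes "dynamical_system X T" and "0 < \<epsilon>" and "\<epsilon> \<le> \<epsilon>'"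
  shows "sep_growth N X T \<epsilon>' \<le> sep_growth N X T \<epsilon>"
  unfolding sep_growth_def
proof (rule Limsup_mono, rule eventually_sequentiallyI)
  fix k :: nat assume k: "1 \<le> k"
  have "0 < sep N X T k \<epsilon>'" "sep N X T k \<epsilon>' \<le> sep N X T k \<epsilon>"
    using sep_ge_1[OF assms(1) k, of \<epsilon>' N] sep_antimono[OF assms(1) k assms(2,3), of N] assms(2,3)
    by linarith+
  then show "ereal (ln (real (sep N X T k \<epsilon>')) / real k) \<le> ereal (ln (real (sep N X T k \<epsilon>)) / real k)"
    by (simp add: divide_right_mono)
qed

lemma sep_growth_tendsto_seq_entropy:
  assumes "dynamical_system X T"
  shows "(sep_growth N X T \<longlongrightarrow> seq_entropy N X T) (at_right 0)"
    and "seq_entropy N X T = (SUP \<epsilon>\<in>{0<..}. sep_growth N X T \<epsilon>)"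
proof -
  let ?s = "SUP \<epsilon>\<in>{0<..}. sep_growth N X T \<epsilon>"
  have lim: "(sep_growth N X T \<longlongrightarrow> ?s) (at_right 0)"
  proof (rule order_tendstoI)
    fix a assume "a < ?s"
    then obtain \<delta> where \<delta>: "\<delta> > 0" "a < sep_growth N X T \<delta>" by (auto simp: less_SUP_iff)
    have "\<forall>\<^sub>F \<epsilon> in at_right 0. \<epsilon> \<in> {0<..<\<delta>}" using \<delta>(1) by (rule eventually_at_right_real)
    then show "\<forall>\<^sub>F \<epsilon> in at_right 0. a < sep_growth N X T \<epsilon>"
    proof (rule eventually_mono)
      fix \<epsilon> :: real assume "\<epsilon> \<in> {0<..<\<delta>}"
      then show "a < sep_growth N X T \<epsilon>"
        using sep_growth_antimono[OF assms, of \<epsilon> \<delta> N] \<delta>(2) by (auto intro: less_le_trans)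
    qed
  next
    fix a assume a: "?s < a"
    have "\<forall>\<^sub>F \<epsilon> in at_right 0. \<epsilon> \<in> {0<..<(1::real)}" by (rule eventually_at_right_real) simp
    then show "\<forall>\<^sub>F \<epsilon> in at_right 0. sep_growth N X T \<epsilon> < a"
    proof (rule eventually_mono)
      fix \<epsilon> :: real assume "\<epsilon> \<in> {0<..<1}"
      then have "sep_growth N X T \<epsilon> \<le> ?s" by (intro SUP_upper) auto
      then show "sep_growth N X T \<epsilon> < a" using a by (rule le_less_trans)
    qed
  qed
  show eq: "seq_entropy N X T = ?s"
    unfolding seq_entropy_def by (rule tendsto_Lim[OF _ lim]) simp
  show "(sep_growth N X T \<longlongrightarrow> seq_entropy N X T) (at_right 0)" using lim by (simp add: eq)
qed

end

theory Submission
  imports Defs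
begin

text \<open>Multi-sensitivity makes the number of separated points double with each new time. Let \<open>\<delta>\<close>
  be a sensitivity constant common to all finite families of open sets, and let \<open>E\<close> be a finite set
  whose points are pairwise more than \<open>\<delta>\<close> apart at some time of a finite set \<open>A\<close>. By continuity
  the separation survives if every point of \<open>E\<close> is moved inside a small enough open neighbourhood.
  Applied to all these neighbourhoods simultaneously, multi-sensitivity provides a single time \<open>n\<close>
  at which each of them contains two points more than \<open>\<delta>\<close> apart. Replacing each point of \<open>E\<close> by
  such a pair gives twice as many points, separated by \<open>A \<union> {n}\<close>: points from different
  neighbourhoods by \<open>A\<close>, points from the same one by \<open>n\<close>. If the neighbourhoods are so small that
  none of their images up to time \<open>M\<close> has diameter above \<open>\<delta>\<close>, then \<open>n > M\<close> automatically, so the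
  chosen times increase (lemma \<open>doubling_step\<close>).

  Iterating from a single point, with \<open>A = {0}\<close>, gives times \<open>0 < n\<^sub>1 < n\<^sub>2 < \<dots>\<close> along which
  \<open>2\<^sup>k\<close> points are separated by the first \<open>k + 1\<close> times (lemma \<open>doubling_times\<close>). As the scale \<open>\<delta>\<close>
  does not depend on \<open>k\<close>, the entropy along this sequence is at least \<open>ln 2\<close>.\<close>

text \<open>Separation refers to a set of times, not to a prefix of a sequence, because the sequence is
  still under construction when the points are chosen; adding a time is then an \<open>insert\<close>.\<close>

definition separated_by_times ::
  "('a::metric_space \<Rightarrow> 'a) \<Rightarrow> real \<Rightarrow> nat set \<Rightarrow> 'a set \<Rightarrow> bool" where
  "separated_by_times T \<delta> A E \<longleftrightarrow>
     (\<forall>x\<in>E. \<forall>y\<in>E. x \<noteq> y \<longrightarrow> (\<exists>t\<in>A. \<delta> < dist ((T ^^ t) x) ((T ^^ t) y)))"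

text \<open>A finite set has only finitely many pairs, so its strict separation leaves a uniform margin
  inside which its points may be moved.\<close>

lemma separated_by_times_margin:
  assumes "finite E" "separated_by_times T \<delta> A E" "\<delta> > 0"
  shows "\<exists>\<eta>>0. 2 * \<eta> \<le> \<delta> \<and> separated_by_times T (\<delta> + 2 * \<eta>) A E"
proof -
  have "\<forall>\<^sub>F \<eta> in at_right 0. \<forall>p\<in>E \<times> E. fst p \<noteq> snd p \<longrightarrow>
      (\<exists>t\<in>A. \<delta> + 2 * \<eta> < dist ((T ^^ t) (fst p)) ((T ^^ t) (snd p)))"
  proof (rule eventually_ball_finite)
    show "finite (E \<times> E)" using assms(1) by simp
    show "\<forall>p\<in>E \<times> E. \<forall>\<^sub>F \<eta> in at_right 0. fst p \<noteq> snd p \<longrightarrow>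
      (\<exists>t\<in>A. \<delta> + 2 * \<eta> < dist ((T ^^ t) (fst p)) ((T ^^ t) (snd p)))"
    proof
      fix p assume p: "p \<in> E \<times> E"
      show "\<forall>\<^sub>F \<eta> in at_right 0. fst p \<noteq> snd p \<longrightarrow>
        (\<exists>t\<in>A. \<delta> + 2 * \<eta> < dist ((T ^^ t) (fst p)) ((T ^^ t) (snd p)))"
      proof (cases "fst p = snd p")
        case False
        then obtain t where t: "t \<in> A" "\<delta> < dist ((T ^^ t) (fst p)) ((T ^^ t) (snd p))"
          using assms(2) p unfolding separated_by_times_def mem_Times_iff by blast
        let ?s = "(dist ((T ^^ t) (fst p)) ((T ^^ t) (snd p)) - \<delta>) / 2"
        have "\<forall>\<^sub>F \<eta> in at_right 0. \<eta> \<in> {0<..<?s}"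
          using t(2) by (intro eventually_at_right_real) simp
        then show ?thesis
        proof (rule eventually_mono, intro impI)
          fix \<eta> assume "\<eta> \<in> {0<..<?s}"
          then have "\<delta> + 2 * \<eta> < dist ((T ^^ t) (fst p)) ((T ^^ t) (snd p))"
            by (simp add: field_simps)
          with t(1) show "\<exists>t\<in>A. \<delta> + 2 * \<eta> < dist ((T ^^ t) (fst p)) ((T ^^ t) (snd p))" by blast
        qed
      qed simp
    qed
  qed
  moreover have "\<forall>\<^sub>F \<eta> in at_right 0. \<eta> \<in> {0<..<\<delta> / 2}"
    using assms(3) by (intro eventually_at_right_real) simp
  ultimately have "\<forall>\<^sub>F \<eta> in at_right 0. \<eta> \<in> {0<..<\<delta> / 2} \<and> separated_by_times T (\<delta> + 2 * \<eta>) A E"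
    by eventually_elim (auto simp: separated_by_times_def)
  then obtain \<eta> where "\<eta> \<in> {0<..<\<delta> / 2} \<and> separated_by_times T (\<delta> + 2 * \<eta>) A E"
    using eventually_happens'[OF trivial_limit_at_right_real] by blast
  then show ?thesis by (intro exI[of _ \<eta>]) auto
qed

lemma opene_Bowen_ball:
  assumes "dynamical_system X T" "x \<in> X" "\<eta> > 0"
  shows "opene X {y \<in> X. \<forall>t\<le>M. dist ((T ^^ t) x) ((T ^^ t) y) < \<eta>}"
proof -
  have "openin (top_of_set X) (\<Inter>t\<in>{..M}. X \<inter> (T ^^ t) -` ball ((T ^^ t) x) \<eta>)"
    using dynamical_system_funpow[OF assms(1)]
    by (intro openin_INT2 continuous_openin_preimage_gen) auto
  moreover have "(\<Inter>t\<in>{..M}. X \<inter> (T ^^ t) -` ball ((T ^^ t) x) \<eta>)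
      = {y \<in> X. \<forall>t\<le>M. dist ((T ^^ t) x) ((T ^^ t) y) < \<eta>}" by auto
  ultimately show ?thesis using assms(2,3) by (auto simp: opene_def)
qed

text \<open>Sensitivity is needed for a whole family of open sets at a common time: this is what allows
  every point of \<open>E\<close> to be doubled at the cost of one new time. The new time lies beyond the bound
  \<open>M\<close> because the neighbourhoods are chosen to stay small under the first \<open>M\<close> iterates.\<close>

lemma doubling_step:
  assumes X: "dynamical_system X T"
    and \<delta>: "\<delta> > 0"
    and sens: "\<And>\<U>. \<lbrakk>finite \<U>; \<forall>U\<in>\<U>. opene X U\<rbrakk> \<Longrightarrow> (\<Inter>U\<in>\<U>. sens_times T U \<delta>) \<noteq> {}"
    and E: "finite E" "E \<noteq> {}" "E \<subseteq> X" "separated_by_times T \<delta> A E"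
    and A: "A \<subseteq> {..M}"
  shows "\<exists>n>M. \<exists>E'. finite E' \<and> E' \<subseteq> X \<and> card E' = 2 * card E \<and>
           separated_by_times T \<delta> (insert n A) E'"
proof -
  obtain \<eta> where \<eta>: "\<eta> > 0" "2 * \<eta> \<le> \<delta>" "separated_by_times T (\<delta> + 2 * \<eta>) A E"
    using separated_by_times_margin[OF E(1,4) \<delta>] by blast
  define U where "U x = {y \<in> X. \<forall>t\<le>M. dist ((T ^^ t) x) ((T ^^ t) y) < \<eta>}" for x
  have "\<forall>V\<in>U ` E. opene X V"
    using opene_Bowen_ball[OF X _ \<eta>(1)] E(3) by (auto simp: U_def)
  then obtain n where "n \<in> (\<Inter>V\<in>U ` E. sens_times T V \<delta>)"
    using sens[of "U ` E"] E(1) by blast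
  then have "\<forall>x\<in>E. \<exists>a b. a \<in> U x \<and> b \<in> U x \<and> \<delta> < dist ((T ^^ n) a) ((T ^^ n) b)"
    unfolding sens_times_def by blast
  then obtain a b where ab: "\<And>x. x \<in> E \<Longrightarrow>
      a x \<in> U x \<and> b x \<in> U x \<and> \<delta> < dist ((T ^^ n) (a x)) ((T ^^ n) (b x))"
    by metis
  \<comment> \<open>Up to time \<open>M\<close> the images of the neighbourhoods have diameter at most \<open>2 * \<eta> \<le> \<delta>\<close>.\<close>
  have "n > M"
  proof (rule ccontr)
    assume "\<not> n > M"
    moreover obtain x where x: "x \<in> E" using E(2) by blast
    ultimately have "dist ((T ^^ n) x) ((T ^^ n) (a x)) < \<eta>" "dist ((T ^^ n) x) ((T ^^ n) (b x)) < \<eta>"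
      using ab[OF x] by (auto simp: U_def)
    then have "dist ((T ^^ n) (a x)) ((T ^^ n) (b x)) < 2 * \<eta>"
      using dist_triangle3[of "(T ^^ n) (a x)" "(T ^^ n) (b x)" "(T ^^ n) x"] by linarith
    with ab[OF x] \<eta>(2) show False by auto
  qed
  define g where "g p = (if snd p then a (fst p) else b (fst p))" for p
  have gU: "g p \<in> U (fst p)" if "p \<in> E \<times> UNIV" for p
    using ab that by (auto simp: g_def)
  have sep_g: "\<exists>t\<in>insert n A. \<delta> < dist ((T ^^ t) (g p)) ((T ^^ t) (g q))"
    if p: "p \<in> E \<times> UNIV" and q: "q \<in> E \<times> UNIV" and "p \<noteq> q" for p q
  proof (cases "fst p = fst q")
    case True
    with \<open>p \<noteq> q\<close> have "snd p \<noteq> snd q" by (simp add: prod_eq_iff)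
    then have "\<delta> < dist ((T ^^ n) (g p)) ((T ^^ n) (g q))"
      using ab[of "fst p"] p True by (auto simp: g_def dist_commute)
    then show ?thesis by blast
  next
    case False
    then obtain t where t: "t \<in> A" "\<delta> + 2 * \<eta> < dist ((T ^^ t) (fst p)) ((T ^^ t) (fst q))"
      using \<eta>(3) p q unfolding separated_by_times_def mem_Times_iff by blast
    have "dist ((T ^^ t) (fst p)) ((T ^^ t) (g p)) < \<eta>" "dist ((T ^^ t) (fst q)) ((T ^^ t) (g q)) < \<eta>"
      using gU[OF p] gU[OF q] t(1) A by (auto simp: U_def)
    with t(2) have "\<delta> < dist ((T ^^ t) (g p)) ((T ^^ t) (g q))"
      using dist_triangle[of "(T ^^ t) (fst p)" "(T ^^ t) (fst q)" "(T ^^ t) (g p)"]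
        dist_triangle2[of "(T ^^ t) (g p)" "(T ^^ t) (fst q)" "(T ^^ t) (g q)"] by linarith
    with t(1) show ?thesis by blast
  qed
  have "inj_on g (E \<times> UNIV)"
  proof (rule inj_onI, rule ccontr)
    fix p q assume "p \<in> E \<times> UNIV" "q \<in> E \<times> UNIV" "g p = g q" "p \<noteq> q"
    then show False using sep_g[of p q] \<delta> by auto
  qed
  then have "card (g ` (E \<times> UNIV)) = 2 * card E"
    by (simp add: card_image card_cartesian_product)
  moreover have "g ` (E \<times> UNIV) \<subseteq> X" using gU by (fastforce simp: U_def)
  moreover have "separated_by_times T \<delta> (insert n A) (g ` (E \<times> UNIV))"
    unfolding separated_by_times_def
  proof (intro ballI impI)
    fix u v assume "u \<in> g ` (E \<times> UNIV)" "v \<in> g ` (E \<times> UNIV)" "u \<noteq> v"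
    then obtain p q where "p \<in> E \<times> UNIV" "q \<in> E \<times> UNIV" "u = g p" "v = g q" by blast
    then show "\<exists>t\<in>insert n A. \<delta> < dist ((T ^^ t) u) ((T ^^ t) v)"
      using sep_g[of p q] \<open>u \<noteq> v\<close> by blast
  qed
  ultimately show ?thesis
    using \<open>n > M\<close> E(1) by (intro exI[of _ n] conjI exI[of _ "g ` (E \<times> UNIV)"]) auto
qed

text \<open>The construction chooses pairs of a point set and the set of times used so far. Each step adds
  a time beyond all earlier ones, so the \<open>k\<close>-th time is recovered as the maximum of the \<open>k\<close>-th set.\<close>

lemma doubling_times:
  assumes X: "dynamical_system X T"
    and \<delta>: "\<delta> > 0"
    and sens: "\<And>\<U>. \<lbrakk>finite \<U>; \<forall>U\<in>\<U>. opene X U\<rbrakk> \<Longrightarrow> (\<Inter>U\<in>\<U>. sens_times T U \<delta>) \<noteq> {}"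
  shows "\<exists>s E. strict_mono s \<and> s 0 = 0 \<and>
           (\<forall>k. E k \<subseteq> X \<and> card (E k) = 2 ^ k \<and> separated_by_times T \<delta> (s ` {..k}) (E k))"
proof -
  define P where "P k p \<longleftrightarrow> fst p \<subseteq> X \<and> card (fst p) = 2 ^ k \<and>
      separated_by_times T \<delta> (snd p) (fst p) \<and> finite (snd p) \<and> snd p \<noteq> {} \<and>
      (k = 0 \<longrightarrow> snd p = {0})" for k :: nat and p :: "'a set \<times> nat set"
  define Q where "Q k p q \<longleftrightarrow> (\<exists>n>Max (snd p). snd q = insert n (snd p))"
    for k :: nat and p q :: "'a set \<times> nat set"
  obtain x where x: "x \<in> X" using X by (auto simp: dynamical_system_def)
  have "\<exists>f. \<forall>k. P k (f k) \<and> Q k (f k) (f (Suc k))"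
  proof (rule dependent_nat_choice)
    have "P 0 ({x}, {0})" using x by (simp add: P_def separated_by_times_def)
    then show "\<exists>p. P 0 p" by blast
  next
    fix p k assume p: "P k p"
    then have "finite (fst p)" "fst p \<noteq> {}"
      by (auto simp: P_def intro: card_ge_0_finite)
    moreover have "snd p \<subseteq> {..Max (snd p)}" using p by (auto simp: P_def)
    moreover have "fst p \<subseteq> X" "separated_by_times T \<delta> (snd p) (fst p)"
      using p by (auto simp: P_def)
    ultimately obtain n E' where "n > Max (snd p)" "finite E'" "E' \<subseteq> X" "card E' = 2 * card (fst p)"
        "separated_by_times T \<delta> (insert n (snd p)) E'"
      using doubling_step[OF X \<delta> sens, of "fst p" "snd p" "Max (snd p)"] by blast
    then have "P (Suc k) (E', insert n (snd p)) \<and> Q k p (E', insert n (snd p))"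
      using p by (auto simp: P_def Q_def)
    then show "\<exists>q. P (Suc k) q \<and> Q k p q" by blast
  qed
  then obtain f where P: "\<And>k. P k (f k)" and Q: "\<And>k. Q k (f k) (f (Suc k))" by blast
  define s where "s k = Max (snd (f k))" for k
  have step: "s k < s (Suc k) \<and> snd (f (Suc k)) = insert (s (Suc k)) (snd (f k))" for k
  proof -
    obtain n where n: "n > Max (snd (f k))" "snd (f (Suc k)) = insert n (snd (f k))"
      using Q[of k] by (auto simp: Q_def)
    then have "s (Suc k) = n" using P[of k] by (simp add: s_def P_def)
    with n show ?thesis by (simp add: s_def)
  qed
  have zero: "snd (f 0) = {0}" using P[of 0] by (simp add: P_def)
  then have s0: "s 0 = 0" by (simp add: s_def)
  have "snd (f k) = s ` {..k}" for k
    by (induction k) (simp_all add: zero s0 step atMost_Suc)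
  then have "\<forall>k. fst (f k) \<subseteq> X \<and> card (fst (f k)) = 2 ^ k \<and>
      separated_by_times T \<delta> (s ` {..k}) (fst (f k))"
    using P by (auto simp: P_def)
  moreover have "strict_mono s" using step by (simp add: strict_mono_Suc_iff)
  ultimately show ?thesis using s0 by (intro exI[of _ s] exI[of _ "\<lambda>k. fst (f k)"]) blast
qed

lemma card_le_sep:
  assumes "dynamical_system X T" "\<epsilon> > 0" "E \<subseteq> X"
    and "separated_by_times T \<epsilon> (seq_time N ` {..k}) E"
  shows "card E \<le> sep N X T (Suc k) \<epsilon>"
proof -
  have "separated N X T (Suc k) \<epsilon> E"
    unfolding separated_def
  proof (intro conjI ballI impI)
    fix x y assume "x \<in> E" "y \<in> E" "x \<noteq> y"
    then obtain j where "j \<le> k" "\<epsilon> < dist ((T ^^ seq_time N j) x) ((T ^^ seq_time N j) y)"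
      using assms(4) by (auto simp: separated_by_times_def)
    then show "\<epsilon> < seq_dist N T (Suc k) x y"
      unfolding seq_dist_def by (subst Max_gr_iff) (auto simp: less_Suc_eq_le)
  qed (fact assms(3))
  then show ?thesis
    unfolding sep_def using finite_card_separated[OF assms(1) _ assms(2)] by (intro Max_ge) auto
qed

text \<open>The exponent lags one behind the number of times, as time \<open>0\<close> contributes no doubling; this
  shift disappears in the exponential growth rate. One scale \<open>\<epsilon>\<close> suffices because the entropy is
  the supremum of the growth rates over all scales.\<close>

lemma ln2_le_seq_entropy:
  assumes X: "dynamical_system X T" and \<epsilon>: "\<epsilon> > 0"
    and sep: "\<And>k. 2 ^ k \<le> sep N X T (Suc k) \<epsilon>"
  shows "ereal (ln 2) \<le> seq_entropy N X T"
proof -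
  have lim: "(\<lambda>k. (real k - 1) / real k * ln 2) \<longlonglongrightarrow> ln 2"
  proof -
    have "(\<lambda>k. (1 - 1 / real k) * ln 2) \<longlonglongrightarrow> (1 - 0) * ln 2"
      by (intro tendsto_intros lim_1_over_n)
    moreover have "\<forall>\<^sub>F k in sequentially. (1 - 1 / real k) * ln 2 = (real k - 1) / real k * ln 2"
      using eventually_gt_at_top[of 0] by eventually_elim (simp add: field_simps)
    ultimately show ?thesis by (auto intro: Lim_transform_eventually)
  qed
  then have "ereal (ln 2) = limsup (\<lambda>k. ereal ((real k - 1) / real k * ln 2))"
    by (intro lim_imp_Limsup[symmetric]) auto
  also have "\<dots> \<le> sep_growth N X T \<epsilon>"
    unfolding sep_growth_def
  proof (rule Limsup_mono, rule eventually_sequentiallyI)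
    fix k :: nat assume "1 \<le> k"
    then obtain m where m: "k = Suc m" by (cases k) auto
    have "real m * ln 2 = ln (2 ^ m)" by (simp add: ln_realpow)
    also have "\<dots> \<le> ln (real (sep N X T k \<epsilon>))"
    proof -
      have "real (2 ^ m) \<le> real (sep N X T k \<epsilon>)"
        using sep[of m] m by (simp only: of_nat_le_iff)
      then have le: "2 ^ m \<le> real (sep N X T k \<epsilon>)" by simp
      show ?thesis by (rule ln_mono[OF le]) simp
    qed
    finally show "ereal ((real k - 1) / real k * ln 2) \<le> ereal (ln (real (sep N X T k \<epsilon>)) / real k)"
      using m by (simp add: divide_right_mono)
  qed
  also have "\<dots> \<le> seq_entropy N X T"
    using \<epsilon> unfolding sep_growth_tendsto_seq_entropy(2)[OF X] by (intro SUP_upper) simp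
  finally show ?thesis .
qed

theorem proposition6p1:
  fixes X :: "'a::metric_space set" and T :: "'a \<Rightarrow> 'a"
  assumes "dynamical_system X T"
    and "multi_sensitive X T"
  shows "\<exists>N :: nat \<Rightarrow> nat. strict_mono N \<and> (\<forall>i. 0 < N i) \<and> 0 < seq_entropy N X T"
proof -
  obtain \<delta> where \<delta>: "\<delta> > 0"
    and all: "\<forall>\<U>. finite \<U> \<and> (\<forall>U\<in>\<U>. opene X U) \<longrightarrow> (\<Inter>U\<in>\<U>. sens_times T U \<delta>) \<noteq> {}"
    using assms(2) unfolding multi_sensitive_def by (elim exE conjE)
  have sens: "(\<Inter>U\<in>\<U>. sens_times T U \<delta>) \<noteq> {}" if "finite \<U>" "\<forall>U\<in>\<U>. opene X U" for \<U>
    using all[rule_format, OF conjI[OF that]] .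
  obtain s E where s: "strict_mono s" "s 0 = 0"
    and E: "\<And>k. E k \<subseteq> X" "\<And>k. card (E k) = 2 ^ k"
      "\<And>k. separated_by_times T \<delta> (s ` {..k}) (E k)"
    using doubling_times[OF assms(1) \<delta> sens] by blast
  define N where "N i = s (Suc i)" for i
  have "seq_time N = s"
    using s(2) by (auto simp: seq_time_def N_def fun_eq_iff split: nat.split)
  then have "2 ^ k \<le> sep N X T (Suc k) \<delta>" for k
    using card_le_sep[OF assms(1) \<delta> E(1)[of k], of N k] E(2,3)[of k] by simp
  then have "ereal (ln 2) \<le> seq_entropy N X T" by (rule ln2_le_seq_entropy[OF assms(1) \<delta>])
  moreover have "0 < ereal (ln 2)" by simp
  ultimately have "0 < seq_entropy N X T" by (rule less_le_trans[rotated])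
  moreover have "strict_mono N" using s(1) by (simp add: N_def strict_mono_def)
  moreover have "\<forall>i. 0 < N i"
    using strict_monoD[OF s(1), of 0] s(2) by (simp add: N_def)
  ultimately show ?thesis by blast
qed

end
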